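(* Let $S$ be a confluent fragment of $\lambda_{lin}^{\to}$, viewed as a fragment of $\lambda_{lin}^{=}$. For every term $M\in S$ and every value $V$: if $M\to^{=*}_{\ell\cup\beta}V$ (algebraic equality restricted to $S$), then there is a value $V'$ with $M\to^{*}_{\ell\cup\beta}V'$ and $V(\to^{=}_\ell)^{*}V'$ (algebraic equality restricted to $S$).
   Context: Fix a ring of scalars (elements $\alpha,\beta$). Terms, values and base terms are given by: $M,N,L ::= V \mid (M)~N \mid \alpha.M \mid M+N$ (terms); $U,V,W ::= 0 \mid B \mid \alpha.V \mid V+W$ (values); $B ::= x \mid \lambda x\,M$ (base terms). $M[x:=N]$ is capture-avoiding substitution. Below $V$ is a value and $B$ a base term. Rewrite rules: $(\beta_v)$ $(\lambda x\,M)~B\to M[x:=B]$. $(A_l)$ $(M+N)~V\to(M)~V+(N)~V$; $(\alpha.M)~V\to\alpha.(M)~V$; $(0)~V\to 0$. $(A_r)$ $(B)~(M+N)\to(B)~M+(B)~N$; $(B)~(\alpha.M)\to\alpha.(B)~M$; $(B)~0\to 0$. (Asso) $M+(N+L)\to(M+N)+L$ and $(M+N)+L\to M+(N+L)$. (Com) $M+N\to N+M$. $(F)$ $\alpha.M+\beta.M\to(\alpha+\beta).M$; $\alpha.M+M\to(\alpha+1).M$; $M+M\to(1+1).M$; $\alpha.(\beta.M)\to(\alpha\beta).M$. $(S)$ $\alpha.(M+N)\to\alpha.M+\alpha.N$; $1.M\to M$; $0.M\to 0$; $\alpha.0\to 0$; $0+M\to M$. Context rules $(\xi)$: from $M\to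 M'$ infer $(M)~N\to(M')~N$, $M+N\to M'+N$, $N+M\to N+M'$, $\alpha.M\to\alpha.M'$. Context rule $(\xi_{lin})$: from $M\to M'$ infer $(V)~M\to(V)~M'$ for $V$ a value. Let $L=\mathrm{Asso}\cup\mathrm{Com}\cup F\cup S$. $\to_\ell$ is generated by $A_l\cup A_r\cup L$ closed under $\xi,\xi_{lin}$; $\to_{\beta_v}$ is generated by $\beta_v$ closed under $\xi,\xi_{lin}$; $\to_{\ell\cup\beta}:=\to_\ell\cup\to_{\beta_v}$ (language $\lambda_{lin}^{\to}$). $R^{*}$ is reflexive-transitive closure. A fragment of $\lambda_{lin}^{\to}$ is a set $S$ of terms closed under $\to_{\ell\cup\beta}$, with the relation restricted to $S$; it is confluent if $\to_{\ell\cup\beta}$ restricted to $S$ is confluent. As a fragment of $\lambda_{lin}^{=}$, $S$ carries the restricted algebraic equality: $M\to^{=}_\ell N$ iff $M,N\in S$ and ($M\to_\ell N$ or $N\to_\ell M$); and $\to^{=}_{\ell\cup\beta}$ is this relation union $\to_{\beta_v}$. *)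

theory Defs
  imports Main "HOL-Library.Confluence"
begin

text \<open>
  Terms are considered up to renaming of bound variables, represented with de Bruijn
  indices; an index that points past all enclosing binders is a free variable.
  \<open>App M N\<close> is \<open>(M) N\<close>, \<open>Scale a M\<close> is \<open>a.M\<close> and \<open>Plus M N\<close> is \<open>M + N\<close>; sums are not
  identified modulo associativity and commutativity.
\<close>

datatype 's trm =
    Zero
  | Var nat
  | Lam "'s trm"
  | App "'s trm" "'s trm"
  | Scale 's "'s trm"
  | Plus "'s trm" "'s trm"

inductive is_base :: "'s trm \<Rightarrow> bool" where
  "is_base (Var i)"
| "is_base (Lam M)"

inductive is_val :: "'s trm \<Rightarrow> bool" where
  "is_val Zero"
| "is_base B \<Longrightarrow> is_val B"
| "is_val V \<Longrightarrow> is_val (Scale a V)"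
| "is_val V \<Longrightarrow> is_val W \<Longrightarrow> is_val (Plus V W)"

primrec lift :: "'s trm \<Rightarrow> nat \<Rightarrow> 's trm" where
  "lift Zero k = Zero"
| "lift (Var i) k = (if i < k then Var i else Var (Suc i))"
| "lift (Lam M) k = Lam (lift M (Suc k))"
| "lift (App M N) k = App (lift M k) (lift N k)"
| "lift (Scale a M) k = Scale a (lift M k)"
| "lift (Plus M N) k = Plus (lift M k) (lift N k)"

text \<open>
  \<open>subst M N k\<close> replaces index \<open>k\<close> by \<open>N\<close> and decrements the indices above \<open>k\<close>, because
  the binder of \<open>k\<close> disappears when a redex is contracted.
\<close>

primrec subst :: "'s trm \<Rightarrow> 's trm \<Rightarrow> nat \<Rightarrow> 's trm" where
  "subst Zero N k = Zero"
| "subst (Var i) N k = (if k < i then Var (i - 1) else if i = k then N else Var i)"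
| "subst (Lam M) N k = Lam (subst M (lift N 0) (Suc k))"
| "subst (App M L) N k = App (subst M N k) (subst L N k)"
| "subst (Scale a M) N k = Scale a (subst M N k)"
| "subst (Plus M L) N k = Plus (subst M N k) (subst L N k)"

inductive rule_beta_v :: "'s trm \<Rightarrow> 's trm \<Rightarrow> bool" where
  "is_base B \<Longrightarrow> rule_beta_v (App (Lam M) B) (subst M B 0)"

inductive rule_Al :: "'s trm \<Rightarrow> 's trm \<Rightarrow> bool" where
  "is_val V \<Longrightarrow> rule_Al (App (Plus M N) V) (Plus (App M V) (App N V))"
| "is_val V \<Longrightarrow> rule_Al (App (Scale a M) V) (Scale a (App M V))"
| "is_val V \<Longrightarrow> rule_Al (App Zero V) Zero"

inductive rule_Ar :: "'s trm \<Rightarrow> 's trm \<Rightarrow> bool" where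
  "is_base B \<Longrightarrow> rule_Ar (App B (Plus M N)) (Plus (App B M) (App B N))"
| "is_base B \<Longrightarrow> rule_Ar (App B (Scale a M)) (Scale a (App B M))"
| "is_base B \<Longrightarrow> rule_Ar (App B Zero) Zero"

inductive rule_Asso :: "'s trm \<Rightarrow> 's trm \<Rightarrow> bool" where
  "rule_Asso (Plus M (Plus N L)) (Plus (Plus M N) L)"
| "rule_Asso (Plus (Plus M N) L) (Plus M (Plus N L))"

inductive rule_Com :: "'s trm \<Rightarrow> 's trm \<Rightarrow> bool" where
  "rule_Com (Plus M N) (Plus N M)"

text \<open>
  Scalars form a unital ring, not assumed commutative. The sort \<open>{ring, monoid_mult}\<close> is used
  rather than \<open>ring_1\<close> because the latter additionally imposes \<open>0 \<noteq> 1\<close>.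
\<close>

inductive rule_F :: "'s::{ring,monoid_mult} trm \<Rightarrow> 's trm \<Rightarrow> bool" where
  "rule_F (Plus (Scale a M) (Scale b M)) (Scale (a + b) M)"
| "rule_F (Plus (Scale a M) M) (Scale (a + 1) M)"
| "rule_F (Plus M M) (Scale (1 + 1) M)"
| "rule_F (Scale a (Scale b M)) (Scale (a * b) M)"

inductive rule_S :: "'s::{ring,monoid_mult} trm \<Rightarrow> 's trm \<Rightarrow> bool" where
  "rule_S (Scale a (Plus M N)) (Plus (Scale a M) (Scale a N))"
| "rule_S (Scale 1 M) M"
| "rule_S (Scale 0 M) Zero"
| "rule_S (Scale a Zero) Zero"
| "rule_S (Plus Zero M) M"

definition rule_L :: "'s::{ring,monoid_mult} trm \<Rightarrow> 's trm \<Rightarrow> bool" where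
  "rule_L = sup (sup rule_Asso rule_Com) (sup rule_F rule_S)"

text \<open>
  Closure under the context rules \<open>\<xi>\<close> (no reduction under \<open>Lam\<close>) and \<open>\<xi>\<^sub>l\<^sub>i\<^sub>n\<close>
  (reduction of an argument only when the function is a value).
\<close>

inductive ctxt :: "('s trm \<Rightarrow> 's trm \<Rightarrow> bool) \<Rightarrow> 's trm \<Rightarrow> 's trm \<Rightarrow> bool"
  for R where
  rule: "R M M' \<Longrightarrow> ctxt R M M'"
| xi_App: "ctxt R M M' \<Longrightarrow> ctxt R (App M N) (App M' N)"
| xi_Plus_left: "ctxt R M M' \<Longrightarrow> ctxt R (Plus M N) (Plus M' N)"
| xi_Plus_right: "ctxt R M M' \<Longrightarrow> ctxt R (Plus N M) (Plus N M')"
| xi_Scale: "ctxt R M M' \<Longrightarrow> ctxt R (Scale a M) (Scale a M')"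
| xi_lin: "is_val V \<Longrightarrow> ctxt R M M' \<Longrightarrow> ctxt R (App V M) (App V M')"

definition step_l :: "'s::{ring,monoid_mult} trm \<Rightarrow> 's trm \<Rightarrow> bool" where
  "step_l = ctxt (sup (sup rule_Al rule_Ar) rule_L)"

definition step_beta :: "'s trm \<Rightarrow> 's trm \<Rightarrow> bool" where
  "step_beta = ctxt rule_beta_v"

definition step_lbeta :: "'s::{ring,monoid_mult} trm \<Rightarrow> 's trm \<Rightarrow> bool" where
  "step_lbeta = sup step_l step_beta"

definition restrict_rel :: "('a \<Rightarrow> 'a \<Rightarrow> bool) \<Rightarrow> 'a set \<Rightarrow> 'a \<Rightarrow> 'a \<Rightarrow> bool" where
  "restrict_rel R S M N \<longleftrightarrow> M \<in> S \<and> N \<in> S \<and> R M N"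

definition fragment :: "'s::{ring,monoid_mult} trm set \<Rightarrow> bool" where
  "fragment S \<longleftrightarrow> (\<forall>M\<in>S. \<forall>N. step_lbeta M N \<longrightarrow> N \<in> S)"

definition confluent_fragment :: "'s::{ring,monoid_mult} trm set \<Rightarrow> bool" where
  "confluent_fragment S \<longleftrightarrow> fragment S \<and> confluentp (restrict_rel step_lbeta S)"

definition eq_step_l :: "'s::{ring,monoid_mult} trm set \<Rightarrow> 's trm \<Rightarrow> 's trm \<Rightarrow> bool" where
  "eq_step_l S M N \<longleftrightarrow> M \<in> S \<and> N \<in> S \<and> (step_l M N \<or> step_l N M)"

text \<open>
  Only the algebraic steps are symmetric. \<open>step_beta\<close> needs no restriction to \<open>S\<close> below: a
  fragment is closed under it, so no such step leaves \<open>S\<close>.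
\<close>

definition eq_step_lbeta :: "'s::{ring,monoid_mult} trm set \<Rightarrow> 's trm \<Rightarrow> 's trm \<Rightarrow> bool" where
  "eq_step_lbeta S = sup (eq_step_l S) step_beta"

end

theory Submission
  imports Defs
begin

text \<open>
  Every step of \<open>eq_step_lbeta S\<close> joins two convertible terms of the fragment, so by the
  Church-Rosser property \<open>M\<close> and \<open>V\<close> have a common reduct. A value contains no application
  outside abstractions, so it only has algebraic reducts, which are again values; hence
  the common reduct is the required value.
\<close>

lemma is_val_simps [simp]:
  "is_val Zero"
  "\<not> is_val (App M N)"
  "is_val (Scale a M) \<longleftrightarrow> is_val M"
  "is_val (Plus M N) \<longleftrightarrow> is_val M \<and> is_val N"
  by (subst is_val.simps; simp add: is_base.simps)+

text \<open>A value is never an application, so the cases \<open>xi_App\<close> and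
  \<open>xi_lin\<close> are vacuous. The sum and scalar contexts act on subterms that are values
  themselves, which leaves only steps at the root.\<close>

lemma ctxt_preserves_val:
  assumes "ctxt R M M'" and "is_val M"
    and "\<And>N N'. R N N' \<Longrightarrow> is_val N \<Longrightarrow> is_val N'"
  shows "is_val M'"
  using assms by induction auto

lemma step_l_preserves_val: "step_l M M' \<Longrightarrow> is_val M \<Longrightarrow> is_val M'"
  unfolding step_l_def
  by (erule ctxt_preserves_val)
    (auto simp: rule_L_def elim!: rule_Al.cases rule_Ar.cases rule_Asso.cases
      rule_Com.cases rule_F.cases rule_S.cases)

lemma not_step_beta_val: "step_beta M M' \<Longrightarrow> \<not> is_val M"
  unfolding step_beta_def
  by (induction rule: ctxt.induct) (auto simp: rule_beta_v.simps)

text \<open>Being a value is carried along the induction: it rules out \<open>step_beta\<close> at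
  each stage, so every step is algebraic, and the restriction keeps both its ends in
  \<open>S\<close>.\<close>

lemma step_lbeta_rtranclp_val:
  assumes "(restrict_rel step_lbeta S)\<^sup>*\<^sup>* V N" and "is_val V"
  shows "is_val N \<and> (eq_step_l S)\<^sup>*\<^sup>* V N"
  using assms
proof (induction rule: rtranclp_induct)
  case (step N N')
  then have "N \<in> S" "N' \<in> S" "step_l N N'"
    by (auto simp: restrict_rel_def step_lbeta_def dest: not_step_beta_val)
  with step show ?case
    by (metis eq_step_l_def rtranclp.rtrancl_into_rtrancl step_l_preserves_val)
qed simp

lemma eq_step_lbeta_convertible:
  assumes "fragment S" and "(eq_step_lbeta S)\<^sup>*\<^sup>* M N" and "M \<in> S"
  shows "N \<in> S \<and> (equivclp (restrict_rel step_lbeta S)) M N"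
  using assms(2,3)
proof (induction rule: rtranclp_induct)
  case (step N N')
  have "N \<in> S" using step.IH step.prems by blast
  \<comment> \<open>A fragment is closed only under forward steps. For a reversed algebraic step,
    membership of \<open>N'\<close> must come from \<open>eq_step_l\<close> itself.\<close>
  consider "N' \<in> S" "step_l N' N" | "step_lbeta N N'"
    using step.hyps(2) by (auto simp: eq_step_lbeta_def eq_step_l_def step_lbeta_def)
  then have "N' \<in> S \<and> (restrict_rel step_lbeta S N N' \<or> restrict_rel step_lbeta S N' N)"
  proof cases
    case 1
    with \<open>N \<in> S\<close> show ?thesis
      by (simp add: restrict_rel_def step_lbeta_def)
  next
    case 2
    with \<open>N \<in> S\<close> assms(1) show ?thesis
      unfolding fragment_def restrict_rel_def by blast
  qed
  moreover have "equivclp (restrict_rel step_lbeta S) M N"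
    using step.IH step.prems by blast
  ultimately show ?case
    by (blast intro: equivclp_into_equivclp)
qed (use assms(3) in simp)

theorem theorem4:
  fixes S :: "'s::{ring,monoid_mult} trm set" and M V :: "'s trm"
  assumes "confluent_fragment S"
    and "M \<in> S"
    and "is_val V"
    and "(eq_step_lbeta S)\<^sup>*\<^sup>* M V"
  shows "\<exists>V'. is_val V' \<and> step_lbeta\<^sup>*\<^sup>* M V' \<and> (eq_step_l S)\<^sup>*\<^sup>* V V'"
proof -
  let ?R = "restrict_rel step_lbeta S"
  have "confluentp ?R" and "equivclp ?R M V"
    using assms eq_step_lbeta_convertible by (auto simp: confluent_fragment_def)
  then obtain N where "?R\<^sup>*\<^sup>* M N" "?R\<^sup>*\<^sup>* V N"
    \<comment> \<open>Semiconfluence is equivalent to the Church-Rosser property: convertible terms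
      have a common reduct.\<close>
    by (auto simp: semiconfluentp_equivclp confluentp_imp_semiconfluentp rtranclp_conversep)
  moreover have "?R \<le> step_lbeta"
    by (auto simp: restrict_rel_def)
  ultimately show ?thesis
    using step_lbeta_rtranclp_val assms(3) rtranclp_mono[of ?R step_lbeta] by blast
qed

end
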